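(* Let $S \in M_{2n}(\mathbb{C})$ be symplectic with eigenvalues $\lambda_1, \lambda_1^{-1}, \lambda_2, \lambda_2^{-1}, \ldots, \lambda_n, \lambda_n^{-1}$ and let $\mu \in \mathbb{C}\setminus\{0\}$ be given. Let $x_1, x_2 \in \mathbb{C}^{2n}$ be eigenvectors of $S$ for $\lambda_1$ and $\lambda_1^{-1}$, respectively, normalized such that $X^T J_{2n} X = J_2$ for $X = [\,x_1 \; x_2\,] \in M_{2n\times 2}(\mathbb{C})$, and set $d := (\mu+\mu^{-1}) - (\lambda_1+\lambda_1^{-1})$. Let $C \in M_{2n\times 2}(\mathbb{C})$. Then the matrix $\hat{S} := S + XC^T \in M_{2n}(\mathbb{C})$ is symplectic and has the eigenvalues $\mu, \mu^{-1}, \lambda_2, \lambda_2^{-1}, \ldots, \lambda_n, \lambda_n^{-1}$ if and only if $C^T = R X^T J_{2n}^T S$ for some matrix $R = [r_{ij}] \in M_2(\mathbb{C})$ whose entries satisfy $$d = \lambda_1 r_{12} - \lambda_1^{-1} r_{21} \quad\text{and}\quad 0 = r_{12} - r_{21} + r_{11}r_{22} - r_{12}r_{21}.$$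
   Context: $M_{m\times n}(\mathbb{C})$ is the set of complex $m\times n$ matrices and $M_n(\mathbb{C}) = M_{n\times n}(\mathbb{C})$. $^T$ denotes the transpose without conjugation. $J_{2n} = \begin{bmatrix} 0 & I_n \\ -I_n & 0\end{bmatrix}\in M_{2n}(\mathbb{R})$, so $J_2 = \begin{bmatrix} 0&1\\-1&0\end{bmatrix}$. A matrix $S\in M_{2n}(\mathbb{C})$ is symplectic if $S^T J_{2n} S = J_{2n}$; its eigenvalues arise in pairs $\lambda_j,\lambda_j^{-1}$. Lists of eigenvalues are counted with algebraic multiplicity. *)

theory Defs
  imports "Jordan_Normal_Form.Char_Poly"
begin

text \<open>The subscript \<open>n\<close> is half the dimension: \<open>J_mat n\<close> has size \<open>2n \<times> 2n\<close>, so the matrix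
  usually written \<open>J\<close> with subscript 2 is \<open>J_mat 1\<close>.\<close>

definition J_mat :: "nat \<Rightarrow> complex mat" where
  "J_mat n = four_block_mat (0\<^sub>m n n) (1\<^sub>m n) (- 1\<^sub>m n) (0\<^sub>m n n)"

definition symplectic :: "nat \<Rightarrow> complex mat \<Rightarrow> bool" where
  "symplectic n S \<longleftrightarrow>
     S \<in> carrier_mat (2 * n) (2 * n) \<and> transpose_mat S * J_mat n * S = J_mat n"

text \<open>Eigenvalues with algebraic multiplicity.\<close>

definition eigenvalue_mset :: "complex mat \<Rightarrow> complex multiset" where
  "eigenvalue_mset A = proots (char_poly A)"

text \<open>Whenever this is the eigenvalue multiset of a symplectic matrix, no \<open>l j\<close> with \<open>j \<in> I\<close> is zero,
  because the matrix is invertible; the convention \<open>inverse 0 = 0\<close> thus plays no role.\<close>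

definition inverse_pairs :: "(nat \<Rightarrow> complex) \<Rightarrow> nat set \<Rightarrow> complex multiset" where
  "inverse_pairs l I = (\<Sum>j\<in>I. {#l j, inverse (l j)#})"

end

theory Submission
  imports Defs
begin

text \<open>
  Put \<open>D = C\<^sup>T\<close>, \<open>W = X\<^sup>T J\<^sup>T S\<close> and \<open>K = X\<^sup>T J X\<close>, where \<open>K\<close> is the
  \<open>2 \<times> 2\<close> symplectic form. The two parts of the claim separate: the factorization \<open>D = R W\<close>
  and the quadratic condition on \<open>R\<close> say that the update is symplectic, and, given these, the
  condition on \<open>d\<close> says that the eigenvalues are the wanted ones.

  Symplecticity. Let \<open>T = S + X D\<close>. If \<open>T\<close> is symplectic, subtracting \<open>S\<^sup>T J S = J\<close> from
  \<open>T\<^sup>T J T = J\<close> in the form \<open>T\<^sup>T J (T - S) = (S - T)\<^sup>T J S\<close> gives \<open>T\<^sup>T J X D = D\<^sup>T W\<close>. The matrix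
  \<open>T\<^sup>T J X\<close> is left invertible because \<open>T\<close> and \<open>J\<close> are invertible and the columns of \<open>X\<close> are
  independent, so \<open>D\<close> is a left multiple \<open>R W\<close> of \<open>W\<close> (\<open>symplectic_add_factors\<close>). For \<open>D\<close> of this
  form, \<open>T\<^sup>T J T - J = W\<^sup>T (R - R\<^sup>T + R\<^sup>T K R) W\<close>, and \<open>W\<close> is right invertible, so \<open>T\<close> is symplectic
  exactly if the middle factor vanishes (\<open>symplectic_low_rank_update_iff\<close>). That factor is a
  skew-symmetric \<open>2 \<times> 2\<close> matrix, hence a single scalar equation (\<open>quadratic_equation_2\<close>).

  Eigenvalues. The columns of \<open>X\<close> span an \<open>S\<close>-invariant plane: \<open>S X = X L\<close> with \<open>L\<close> diagonal.
  A perturbation \<open>X D\<close> with range in that plane changes only the eigenvalues belonging to the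
  plane: the spectrum of \<open>L\<close> is replaced by that of \<open>L + D X\<close>, the compression of \<open>T\<close> to the plane
  (\<open>char_poly_add_low_rank_intertwined\<close>). When \<open>R\<close> satisfies the quadratic equation, \<open>L + D X\<close> has
  determinant 1, so its eigenvalues are reciprocal and determined by its trace; they are \<open>\<mu>\<close> and
  \<open>\<mu>\<^sup>-\<^sup>1\<close> exactly if the trace is \<open>\<mu> + \<mu>\<^sup>-\<^sup>1\<close>, which is the condition on \<open>d\<close>
  (\<open>char_poly_compression\<close>, \<open>proots_reciprocal_quadratic\<close>).
\<close>

section \<open>Matrix algebra\<close>

text \<open>The distributive, associative and transposition laws are restated with dimension equations as
  premises. Unlike membership in \<open>carrier_mat\<close>, these leave no dimension to be guessed, so the
  simplifier can expand whole matrix expressions with \<open>mat_expand\<close>.\<close>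

lemma mat_mult_assoc_dim:
  fixes A B C :: "'a :: semiring_0 mat"
  assumes "dim_col A = dim_row B" "dim_col B = dim_row C"
  shows "A * B * C = A * (B * C)"
  using assms by (intro assoc_mult_mat) auto

lemma mat_distrib_dim:
  fixes A B C :: "'a :: semiring_0 mat"
  shows "dim_row A = dim_row B \<Longrightarrow> dim_col A = dim_col B \<Longrightarrow> dim_col B = dim_row C \<Longrightarrow>
      (A + B) * C = A * C + B * C"
    and "dim_row B = dim_row C \<Longrightarrow> dim_col B = dim_col C \<Longrightarrow> dim_col A = dim_row B \<Longrightarrow>
      A * (B + C) = A * B + A * C"
  by (intro add_mult_distrib_mat mult_add_distrib_mat; auto)+

lemma mat_diff_distrib_dim:
  fixes A B C :: "'a :: ring mat"
  shows "dim_row A = dim_row B \<Longrightarrow> dim_col A = dim_col B \<Longrightarrow> dim_col B = dim_row C \<Longrightarrow>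
      (A - B) * C = A * C - B * C"
    and "dim_row B = dim_row C \<Longrightarrow> dim_col B = dim_col C \<Longrightarrow> dim_col A = dim_row B \<Longrightarrow>
      A * (B - C) = A * B - A * C"
  by (intro minus_mult_distrib_mat mult_minus_distrib_mat; auto)+

lemma mat_transpose_dim:
  fixes A B :: "'a :: comm_semiring_0 mat"
  shows "dim_col A = dim_row B \<Longrightarrow> transpose_mat (A * B) = transpose_mat B * transpose_mat A"
    and "dim_row A = dim_row B \<Longrightarrow> dim_col A = dim_col B \<Longrightarrow>
      transpose_mat (A + B) = transpose_mat A + transpose_mat B"
  by (intro transpose_mult transpose_add; auto)+

lemmas mat_expand = mat_mult_assoc_dim mat_distrib_dim mat_diff_distrib_dim mat_transpose_dim

lemma mat_add_cancel_left:
  fixes A E :: "'a :: ab_group_add mat"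
  assumes "A \<in> carrier_mat r c" "E \<in> carrier_mat r c"
  shows "A + E = A \<longleftrightarrow> E = 0\<^sub>m r c"
  using assms by (auto simp: mat_eq_iff)

lemma mat_congruence_eq_0_iff:
  fixes M W V :: "'a :: comm_ring_1 mat"
  assumes M: "M \<in> carrier_mat k k" and W: "W \<in> carrier_mat k m" and V: "V \<in> carrier_mat m k"
    and WV: "W * V = 1\<^sub>m k"
  shows "transpose_mat W * M * W = 0\<^sub>m m m \<longleftrightarrow> M = 0\<^sub>m k k"
proof
  assume 0: "transpose_mat W * M * W = 0\<^sub>m m m"
  have "M = transpose_mat (W * V) * M * (W * V)"
    using M by (simp add: WV)
  also have "\<dots> = transpose_mat V * (transpose_mat W * M * W) * V"
    using M W V by (simp add: mat_expand)
  also have "\<dots> = 0\<^sub>m k k"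
    using V by (simp add: 0)
  finally show "M = 0\<^sub>m k k" .
qed (use M W in simp)

lemma mat_2_eq_iff:
  assumes "A \<in> carrier_mat 2 2" "B \<in> carrier_mat 2 2"
  shows "A = B \<longleftrightarrow> A $$ (0, 0) = B $$ (0, 0) \<and> A $$ (0, 1) = B $$ (0, 1) \<and>
    A $$ (1, 0) = B $$ (1, 0) \<and> A $$ (1, 1) = B $$ (1, 1)"
  using assms by (auto simp: mat_eq_iff less_2_cases_iff)

lemma index_mult_mat_2:
  assumes "A \<in> carrier_mat r 2" "B \<in> carrier_mat 2 c" "i < r" "j < c"
  shows "(A * B) $$ (i, j) = A $$ (i, 0) * B $$ (0, j) + A $$ (i, 1) * B $$ (1, j)"
  using assms by (auto simp: scalar_prod_def numeral_2_eq_2)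

lemma det_mat_2:
  fixes A :: "'a :: comm_ring_1 mat"
  assumes "A \<in> carrier_mat 2 2"
  shows "det A = A $$ (0, 0) * A $$ (1, 1) - A $$ (0, 1) * A $$ (1, 0)"
proof -
  have "det (mat_delete A i 0) = mat_delete A i 0 $$ (0, 0)" if "i < 2" for i
    using assms by (intro det_single) (auto simp: mat_delete_def)
  moreover have "mat_delete A 0 0 $$ (0, 0) = A $$ (1, 1)" "mat_delete A 1 0 $$ (0, 0) = A $$ (0, 1)"
    using assms by (auto simp: mat_delete_def)
  ultimately show ?thesis
    using assms by (subst laplace_expansion_column[of _ 2 0]) 
      (auto simp: numeral_2_eq_2 cofactor_def)
qed

lemma char_poly_mat_2:
  fixes A :: "'a :: comm_ring_1 mat"
  assumes "A \<in> carrier_mat 2 2"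
  shows "char_poly A = [:A $$ (0, 0) * A $$ (1, 1) - A $$ (0, 1) * A $$ (1, 0),
    - (A $$ (0, 0) + A $$ (1, 1)), 1:]"
  using assms unfolding char_poly_def
  by (subst det_mat_2) (auto simp: char_poly_matrix_def)

section \<open>Characteristic polynomial of a perturbation with range in an invariant subspace\<close>

text \<open>For invertible \<open>A\<close> and \<open>B\<close> the hypothesis reads \<open>A\<^sup>-\<^sup>1 X = X B\<^sup>-\<^sup>1\<close>, and the claim is the
  matrix determinant lemma. Two evaluations of the determinant of the block matrix
  \<open>M = (A, X; D, 1)\<close> avoid all inverses, which matters because the entries will be polynomials.\<close>

lemma det_add_low_rank_intertwined:
  fixes A :: "'a :: idom mat"
  assumes A: "A \<in> carrier_mat n n" and X: "X \<in> carrier_mat n k"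
    and B: "B \<in> carrier_mat k k" and D: "D \<in> carrier_mat k n"
    and AX: "A * X = X * B"
  shows "det (A - X * D) * det B = det A * det (B - D * X)"
proof -
  define M where "M = four_block_mat A X D (1\<^sub>m k)"
  have M: "M \<in> carrier_mat (n + k) (n + k)"
    using A X D by (auto simp: M_def)
  have "M = four_block_mat (1\<^sub>m n) X (0\<^sub>m k n) (1\<^sub>m k)
          * four_block_mat (A - X * D) (0\<^sub>m n k) D (1\<^sub>m k)"
    using A X D by (subst mult_four_block_mat[of _ n n _ k _ k]) 
      (auto simp: M_def intro!: cong_four_block_mat)
  then have "det M = det (four_block_mat (1\<^sub>m n) X (0\<^sub>m k n) (1\<^sub>m k))
          * det (four_block_mat (A - X * D) (0\<^sub>m n k) D (1\<^sub>m k))"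
    using A X D by (subst det_mult[symmetric, of _ "n + k"]) auto
  also have "\<dots> = det (A - X * D)"
    using A X D
    by (subst det_four_block_mat_lower_left_zero[of _ n _ k], simp_all,
        subst det_four_block_mat_upper_right_zero[of _ n _ k], auto)
  finally have left: "det M = det (A - X * D)" .
  \<comment> \<open>Column operations clear the upper right block, by \<open>A X = X B\<close>, at the cost of \<open>det B\<close>.\<close>
  have "M * four_block_mat (1\<^sub>m n) (- X) (0\<^sub>m k n) B
      = four_block_mat A (0\<^sub>m n k) D (B - D * X)"
  proof -
    have "A * (- X) + X * B = 0\<^sub>m n k"
      using A X B AX by (simp add: uminus_l_inv_mat)
    moreover have "D * (- X) + 1\<^sub>m k * B = B - D * X"
      using B D X by (intro eq_matI) auto
    ultimately show ?thesis
      using A X D B unfolding M_def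
      by (subst mult_four_block_mat[of _ n n _ k _ k]) (auto intro!: cong_four_block_mat)
  qed
  then have "det M * det (four_block_mat (1\<^sub>m n) (- X) (0\<^sub>m k n) B)
      = det (four_block_mat A (0\<^sub>m n k) D (B - D * X))"
    using M X B by (subst det_mult[symmetric, of _ "n + k"]) auto
  also have "\<dots> = det A * det (B - D * X)"
    using A B D X by (intro det_four_block_mat_upper_right_zero[of _ n _ k]) auto
  also have "det (four_block_mat (1\<^sub>m n) (- X) (0\<^sub>m k n) B) = det B"
    using X B by (subst det_four_block_mat_lower_left_zero[of _ n _ k]) auto
  finally show ?thesis using left by simp
qed

text \<open>The columns of \<open>X\<close> span an invariant subspace of \<open>A\<close>, on which \<open>A\<close> acts as \<open>B\<close> and
  \<open>A + X D\<close> acts as \<open>B + D X\<close>. On the quotient by that subspace \<open>A\<close> and \<open>A + X D\<close> agree. The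
  determinant identity, applied to the characteristic matrices, turns this picture into an
  equation that holds even if the columns of \<open>X\<close> are dependent.\<close>

lemma char_poly_add_low_rank_intertwined:
  fixes A :: "'a :: idom mat"
  assumes A: "A \<in> carrier_mat n n" and X: "X \<in> carrier_mat n k"
    and B: "B \<in> carrier_mat k k" and D: "D \<in> carrier_mat k n"
    and AX: "A * X = X * B"
  shows "char_poly (A + X * D) * char_poly B = char_poly A * char_poly (B + D * X)"
proof -
  let ?c = "map_mat (\<lambda>a::'a. [:a:])"
  have XD: "char_poly_matrix (A + X * D) = char_poly_matrix A - ?c X * ?c D"
    unfolding map_poly_mult(1)[OF X D, symmetric]
    using A X D by (intro eq_matI) (auto simp: char_poly_matrix_def)
  have DX: "char_poly_matrix (B + D * X) = char_poly_matrix B - ?c D * ?c X"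
    unfolding map_poly_mult(1)[OF D X, symmetric]
    using B X D by (intro eq_matI) (auto simp: char_poly_matrix_def)
  have split: "char_poly_matrix E = [:0, 1:] \<cdot>\<^sub>m 1\<^sub>m m + (- ?c E)" if "E \<in> carrier_mat m m" for E :: "'a mat" and m
    using that by (intro eq_matI) (auto simp: char_poly_matrix_def)
  have "char_poly_matrix A * ?c X = [:0, 1:] \<cdot>\<^sub>m ?c X + (- ?c (A * X))"
    using A X by (simp add: split mat_distrib_dim map_poly_mult(1)[OF A X] mult_smult_assoc_mat[of _ n n _ k])
  also have "\<dots> = ?c X * char_poly_matrix B"
    using B X by (simp add: AX split mat_distrib_dim map_poly_mult(1)[OF X B] mult_smult_distrib[of _ n k _ k])
  finally have "char_poly_matrix A * ?c X = ?c X * char_poly_matrix B" .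
  then show ?thesis
    unfolding char_poly_def XD DX using A X B D
    by (intro det_add_low_rank_intertwined[of _ n _ k]) auto
qed

lemma char_poly_nonzero: "A \<in> carrier_mat n n \<Longrightarrow> char_poly (A :: complex mat) \<noteq> 0"
  using degree_monic_char_poly[of A n] by auto

lemma mult_mat_of_eigenvectors:
  fixes S :: "'a :: comm_ring_1 mat"
  assumes S: "S \<in> carrier_mat m m" and "eigenvector S x a" and "eigenvector S y b"
  shows "S * mat_of_cols m [x, y] = mat_of_cols m [x, y] * mat_diag 2 (\<lambda>i. if i = 0 then a else b)"
proof -
  let ?X = "mat_of_cols m [x, y]"
  have X: "?X \<in> carrier_mat m 2"
    using mat_of_cols_carrier(1)[of m "[x, y]"] by (simp add: numeral_2_eq_2)
  have x: "x \<in> carrier_vec m" "S *\<^sub>v x = a \<cdot>\<^sub>v x" and y: "y \<in> carrier_vec m" "S *\<^sub>v y = b \<cdot>\<^sub>v y"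
    using assms by (auto simp: eigenvector_def)
  show ?thesis
  proof (rule eq_matI, goal_cases)
    case (1 i j)
    then have i: "i < m" and j: "j = 0 \<or> j = 1"
      by (auto simp: mat_diag_def)
    have "(S * ?X) $$ (i, j) = (S *\<^sub>v ([x, y] ! j)) $ i"
      using S i j x y by auto
    also have "\<dots> = [x, y] ! j $ i * (if j = 0 then a else b)"
      using i j x y by auto
    also have "\<dots> = (?X * mat_diag 2 (\<lambda>i. if i = 0 then a else b)) $$ (i, j)"
      using i j by (auto simp: mat_diag_mult_right[OF X] mat_of_cols_index)
    finally show ?case .
  qed (use S in \<open>auto simp: mat_diag_def\<close>)
qed

section \<open>Low-rank updates of symplectic matrices\<close>

lemma J_mat_carrier [simp]: "J_mat n \<in> carrier_mat (2 * n) (2 * n)"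
  and J_mat_dim [simp]: "dim_row (J_mat n) = 2 * n" "dim_col (J_mat n) = 2 * n"
  by (auto simp: J_mat_def mult_2)

lemma transpose_J_mat: "transpose_mat (J_mat n) = - J_mat n"
  by (rule eq_matI) (auto simp: J_mat_def)

lemma J_mat_mult_transpose: "J_mat n * transpose_mat (J_mat n) = 1\<^sub>m (2 * n)"
  and transpose_mult_J_mat: "transpose_mat (J_mat n) * J_mat n = 1\<^sub>m (2 * n)"
proof -
  have "J_mat n * J_mat n = - 1\<^sub>m (2 * n)"
    unfolding J_mat_def
    by (subst mult_four_block_mat[of _ n n _ n _ n]) (auto intro!: eq_matI)
  then show "J_mat n * transpose_mat (J_mat n) = 1\<^sub>m (2 * n)"
    and "transpose_mat (J_mat n) * J_mat n = 1\<^sub>m (2 * n)"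
    by (auto simp: transpose_J_mat)
qed

text \<open>The condition \<open>S\<^sup>T J S = J\<close> makes \<open>J\<^sup>T S\<^sup>T J\<close> a left inverse of \<open>S\<close>; for square matrices it
  is then also a right inverse.\<close>

lemma symplectic_right_inverse:
  assumes "symplectic n S"
  shows "S * (transpose_mat (J_mat n) * transpose_mat S * J_mat n) = 1\<^sub>m (2 * n)"
proof (rule mat_mult_left_right_inverse)
  have S: "S \<in> carrier_mat (2 * n) (2 * n)" and J: "transpose_mat S * (J_mat n * S) = J_mat n"
    using assms by (auto simp: symplectic_def mat_expand)
  show "S \<in> carrier_mat (2 * n) (2 * n)" by fact
  show "transpose_mat (J_mat n) * transpose_mat S * J_mat n \<in> carrier_mat (2 * n) (2 * n)"
    using S by auto
  show "transpose_mat (J_mat n) * transpose_mat S * J_mat n * S = 1\<^sub>m (2 * n)"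
    using S by (simp add: mat_expand J transpose_mult_J_mat)
qed

lemma symplectic_transpose:
  assumes "symplectic n S"
  shows "S * (transpose_mat (J_mat n) * transpose_mat S) = transpose_mat (J_mat n)"
proof -
  have S: "S \<in> carrier_mat (2 * n) (2 * n)"
    using assms by (auto simp: symplectic_def)
  have "S * (transpose_mat (J_mat n) * transpose_mat S)
      = S * (transpose_mat (J_mat n) * transpose_mat S * J_mat n) * transpose_mat (J_mat n)"
    using S by (simp add: mat_expand J_mat_mult_transpose)
  also have "\<dots> = transpose_mat (J_mat n)"
    unfolding symplectic_right_inverse[OF assms] by simp
  finally show ?thesis .
qed

lemma symplectic_add_iff:
  assumes S: "symplectic n S" and X: "X \<in> carrier_mat (2 * n) k" and D: "D \<in> carrier_mat k (2 * n)"
  shows "symplectic n (S + X * D) \<longleftrightarrow>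
    transpose_mat S * J_mat n * X * D
      + (transpose_mat D * transpose_mat X * J_mat n * S
         + transpose_mat D * transpose_mat X * J_mat n * X * D) = 0\<^sub>m (2 * n) (2 * n)"
proof -
  have S': "S \<in> carrier_mat (2 * n) (2 * n)" and JS: "transpose_mat S * (J_mat n * S) = J_mat n"
    using S by (auto simp: symplectic_def mat_expand)
  let ?E = "transpose_mat S * J_mat n * X * D
      + (transpose_mat D * transpose_mat X * J_mat n * S
         + transpose_mat D * transpose_mat X * J_mat n * X * D)"
  have "transpose_mat (S + X * D) * J_mat n * (S + X * D) = J_mat n + ?E"
    using S' X D
    by (simp add: mat_expand JS) (simp add: mat_eq_iff ac_simps)
  then show ?thesis
    using S' X D by (auto simp: symplectic_def intro!: mat_add_cancel_left)
qed

text \<open>Let \<open>T = S + X D\<close>, \<open>W = X\<^sup>T J\<^sup>T S\<close> and \<open>K = X\<^sup>T J X\<close>. Since \<open>T\<^sup>T J X D = D\<^sup>T W\<close>,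
  multiplication with a left inverse of \<open>T\<^sup>T J X\<close> exhibits \<open>R\<close>. The identity
  \<open>T J\<^sup>T T\<^sup>T = J\<^sup>T\<close>, which says that \<open>T\<^sup>T\<close> preserves the form too, shows that
  \<open>K\<^sup>T X\<^sup>T J T J\<^sup>T\<close> is such a left inverse.\<close>

lemma symplectic_add_factors:
  assumes S: "symplectic n S" and T: "symplectic n (S + X * D)"
    and X: "X \<in> carrier_mat (2 * n) (2 * k)" and D: "D \<in> carrier_mat (2 * k) (2 * n)"
    and XJX: "transpose_mat X * J_mat n * X = J_mat k"
  obtains R where "R \<in> carrier_mat (2 * k) (2 * k)"
    and "D = R * transpose_mat X * transpose_mat (J_mat n) * S"
proof
  define T where "T = S + X * D"
  let ?J = "J_mat n"
  define W where "W = transpose_mat X * transpose_mat ?J * S"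
  define R where "R = transpose_mat (J_mat k) * transpose_mat X * ?J * T * transpose_mat ?J * transpose_mat D"
  have S': "S \<in> carrier_mat (2 * n) (2 * n)" and JS: "transpose_mat S * (?J * S) = ?J"
    using S by (auto simp: symplectic_def mat_expand)
  have T': "T \<in> carrier_mat (2 * n) (2 * n)" and JT: "transpose_mat T * (?J * T) = ?J"
    using T S' X D by (auto simp: T_def symplectic_def mat_expand)
  have XD: "X * D = T - S"
    and TD: "transpose_mat S - transpose_mat T = - (transpose_mat D * transpose_mat X)"
    using S' X D by (auto simp: T_def mat_eq_iff mat_transpose_dim)
  have "transpose_mat T * ?J * (X * D) = ?J - transpose_mat T * ?J * S"
    using S' T' by (simp add: XD mat_expand JT)
  also have "\<dots> = (transpose_mat S - transpose_mat T) * (?J * S)"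
    using S' T' by (simp add: mat_expand JS)
  also have "\<dots> = transpose_mat D * W"
    using S' X D by (simp add: TD W_def transpose_J_mat mat_expand)
  finally have *: "transpose_mat T * ?J * (X * D) = transpose_mat D * W" .
  have "D = transpose_mat (J_mat k) * J_mat k * D"
    using D by (simp add: transpose_mult_J_mat)
  \<comment> \<open>The factor \<open>J J\<^sup>T = 1\<close> is inserted so that its \<open>J\<^sup>T\<close> can be replaced by \<open>T J\<^sup>T T\<^sup>T\<close>.\<close>
  also have "\<dots> = transpose_mat (J_mat k) * (transpose_mat X * (?J * transpose_mat ?J) * ?J * X) * D"
    unfolding J_mat_mult_transpose using X by (simp add: XJX[symmetric])
  also have "\<dots> = transpose_mat (J_mat k) * transpose_mat X * ?J * transpose_mat ?J * ?J * X * D"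
    using X D by (simp add: mat_expand)
  also have "\<dots> = transpose_mat (J_mat k) * transpose_mat X * ?J * T * transpose_mat ?J
      * (transpose_mat T * ?J * (X * D))"
  proof -
    have "T * (transpose_mat ?J * (transpose_mat T * (?J * (X * D)))) = transpose_mat ?J * (?J * (X * D))"
      using arg_cong[OF symplectic_transpose[OF T[folded T_def]], of "\<lambda>A. A * (?J * (X * D))"] X D T'
      by (simp add: mat_expand)
    then show ?thesis
      using X D T' by (simp add: mat_expand)
  qed
  also have "\<dots> = R * W"
    unfolding * using T' X D S' by (simp add: R_def W_def mat_expand)
  also have "\<dots> = R * transpose_mat X * transpose_mat ?J * S"
    using S' X D T' by (simp add: W_def R_def mat_expand)
  finally show "D = R * transpose_mat X * transpose_mat ?J * S" .
  show "R \<in> carrier_mat (2 * k) (2 * k)"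
    unfolding R_def using T' X D by auto
qed

text \<open>The deviation of the updated matrix from being symplectic is a congruence of
  \<open>R - R\<^sup>T + R\<^sup>T K R\<close> by \<open>W = X\<^sup>T J\<^sup>T S\<close>. It detects the middle factor because \<open>W\<close> has the right
  inverse \<open>S\<^sup>-\<^sup>1 X K\<close>, with \<open>S\<^sup>-\<^sup>1 = J\<^sup>T S\<^sup>T J\<close>.\<close>

lemma symplectic_low_rank_update_iff:
  assumes S: "symplectic n S" and X: "X \<in> carrier_mat (2 * n) (2 * k)"
    and XJX: "transpose_mat X * J_mat n * X = J_mat k" and R: "R \<in> carrier_mat (2 * k) (2 * k)"
  shows "symplectic n (S + X * (R * transpose_mat X * transpose_mat (J_mat n) * S)) \<longleftrightarrow>
    R - transpose_mat R + transpose_mat R * J_mat k * R = 0\<^sub>m (2 * k) (2 * k)"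
proof -
  let ?J = "J_mat n"
  define W where "W = transpose_mat X * transpose_mat ?J * S"
  have S': "S \<in> carrier_mat (2 * n) (2 * n)"
    using S by (auto simp: symplectic_def)
  have W: "W \<in> carrier_mat (2 * k) (2 * n)"
    using X S' by (auto simp: W_def)
  have D: "R * transpose_mat X * transpose_mat ?J * S = R * W"
    using X S' R by (simp add: W_def mat_expand)
  have SJX: "transpose_mat S * ?J * X = transpose_mat W"
    and XJS: "transpose_mat X * (?J * S) = - W"
    and XJX': "transpose_mat X * (?J * X) = J_mat k"
    using S' X XJX by (simp_all add: W_def mat_expand transpose_J_mat transpose_uminus)
  have "symplectic n (S + X * (R * W)) \<longleftrightarrow>
    transpose_mat W * (R * W) + (transpose_mat (R * W) * - W + transpose_mat (R * W) * J_mat k * (R * W))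
      = 0\<^sub>m (2 * n) (2 * n)"
  proof -
    have "transpose_mat (R * W) * transpose_mat X * ?J * S = transpose_mat (R * W) * (transpose_mat X * (?J * S))"
     and "transpose_mat (R * W) * transpose_mat X * ?J * X * (R * W)
        = transpose_mat (R * W) * (transpose_mat X * (?J * X)) * (R * W)"
      using S' X W R by (simp_all add: mat_mult_assoc_dim)
    then show ?thesis
      using R W by (simp only: symplectic_add_iff[OF S X mult_carrier_mat[OF R W]] SJX XJS XJX')
  qed
  also have "transpose_mat W * (R * W) + (transpose_mat (R * W) * - W + transpose_mat (R * W) * J_mat k * (R * W))
     = transpose_mat W * (R - transpose_mat R + transpose_mat R * J_mat k * R) * W"
    using R W by (simp add: mat_expand) (simp add: mat_eq_iff)
  also have "\<dots> = 0\<^sub>m (2 * n) (2 * n) \<longleftrightarrow>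
    R - transpose_mat R + transpose_mat R * J_mat k * R = 0\<^sub>m (2 * k) (2 * k)"
  proof (rule mat_congruence_eq_0_iff)
    define V where "V = transpose_mat ?J * transpose_mat S * ?J"
    have SV: "S * V = 1\<^sub>m (2 * n)"
      unfolding V_def by (rule symplectic_right_inverse[OF S])
    have V: "V \<in> carrier_mat (2 * n) (2 * n)"
      using S' by (auto simp: V_def)
    have "transpose_mat (J_mat k) = transpose_mat X * (transpose_mat ?J * X)"
      using X by (simp add: XJX[symmetric] mat_expand)
    then have K: "transpose_mat X * transpose_mat ?J * X * J_mat k = 1\<^sub>m (2 * k)"
      using X by (simp add: mat_expand transpose_mult_J_mat[symmetric])
    have "W * (V * X * J_mat k) = transpose_mat X * transpose_mat ?J * (S * V) * X * J_mat k"
      using S' V X by (simp add: W_def mat_expand)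
    then show "W * (V * X * J_mat k) = 1\<^sub>m (2 * k)"
      using X K by (simp add: SV)
    show "V * X * J_mat k \<in> carrier_mat (2 * n) (2 * k)"
      using V X by auto
  qed (use R W in auto)
  finally show ?thesis
    unfolding D .
qed

section \<open>The two-dimensional case\<close>

text \<open>The unit is written \<open>Suc 0\<close> so that the equations fit the simplifier's normal form.\<close>

lemma J_mat_1_index:
  "J_mat (Suc 0) $$ (0, 0) = 0" "J_mat (Suc 0) $$ (0, Suc 0) = 1"
  "J_mat (Suc 0) $$ (Suc 0, 0) = -1" "J_mat (Suc 0) $$ (Suc 0, Suc 0) = 0"
  by (auto simp: J_mat_def)

text \<open>Both \<open>R - R\<^sup>T\<close> and \<open>R\<^sup>T K R\<close> are skew-symmetric, so only the entry at \<open>(0, 1)\<close> matters;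
  there \<open>R\<^sup>T K R = det R \<cdot> K\<close> contributes the determinant of \<open>R\<close>.\<close>

lemma quadratic_equation_2:
  assumes R: "R \<in> carrier_mat 2 2"
  shows "R - transpose_mat R + transpose_mat R * J_mat 1 * R = 0\<^sub>m 2 2 \<longleftrightarrow>
    0 = R $$ (0, 1) - R $$ (1, 0) + R $$ (0, 0) * R $$ (1, 1) - R $$ (0, 1) * R $$ (1, 0)"
proof -
  have "J_mat 1 \<in> carrier_mat 2 2"
    using J_mat_carrier[of 1] by simp
  with R show ?thesis
    by (subst mat_2_eq_iff)
      (auto simp: index_mult_mat_2[of _ 2 _ 2] J_mat_1_index algebra_simps simp del: index_mult_mat(1))
qed

lemma proots_reciprocal_quadratic:
  fixes \<mu> t :: "'a :: field"
  assumes "\<mu> \<noteq> 0"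
  shows "proots [:1, - t, 1:] = {#\<mu>, inverse \<mu>#} \<longleftrightarrow> t = \<mu> + inverse \<mu>"
proof
  assume "proots [:1, - t, 1:] = {#\<mu>, inverse \<mu>#}"
  then have "\<mu> \<in># proots [:1, - t, 1:]"
    by simp
  then have "poly [:1, - t, 1:] \<mu> = 0"
    by (subst (asm) set_count_proots) auto
  then show "t = \<mu> + inverse \<mu>"
    using assms by (simp add: field_simps)
next
  assume "t = \<mu> + inverse \<mu>"
  then have "[:1, - t, 1:] = [:- \<mu>, 1:] * [:- inverse \<mu>, 1:]"
    using assms by simp
  then show "proots [:1, - t, 1:] = {#\<mu>, inverse \<mu>#}"
    by (simp only:) (subst proots_mult; simp)
qed

text \<open>The matrix \<open>L + R K\<^sup>T L\<close> is the compression \<open>L + D X\<close> of the updated matrix to the plane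
  spanned by \<open>X\<close>, because \<open>D X = R X\<^sup>T J\<^sup>T S X = R K\<^sup>T L\<close>. The constant coefficient is written so
  that the polynomial of \<open>quadratic_equation_2\<close> is visible: it is 1 exactly if that polynomial
  vanishes at \<open>R\<close>.\<close>

lemma char_poly_compression:
  fixes a b :: complex
  assumes ab: "a * b = 1" and R: "R \<in> carrier_mat 2 2"
  defines "L \<equiv> mat_diag 2 (\<lambda>i. if i = 0 then a else b)"
  shows "char_poly (L + R * transpose_mat (J_mat 1) * L) =
    [:1 + (R $$ (0, 1) - R $$ (1, 0) + R $$ (0, 0) * R $$ (1, 1) - R $$ (0, 1) * R $$ (1, 0)),
      - (a + b + (a * R $$ (0, 1) - b * R $$ (1, 0))), 1:]"
proof -
  have J: "transpose_mat (J_mat 1) \<in> carrier_mat 2 2"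
    using J_mat_carrier[of 1] by simp
  have L: "L \<in> carrier_mat 2 2"
    by (simp add: L_def)
  have Lij: "L $$ (0, 0) = a" "L $$ (0, 1) = 0" "L $$ (1, 0) = 0" "L $$ (1, 1) = b"
    by (auto simp: L_def mat_diag_def)
  let ?M = "L + R * transpose_mat (J_mat 1) * L"
  have "?M $$ (0, 0) = a + a * R $$ (0, 1)" "?M $$ (0, 1) = - (b * R $$ (0, 0))"
    "?M $$ (1, 0) = a * R $$ (1, 1)" "?M $$ (1, 1) = b - b * R $$ (1, 0)"
    using L J R Lij
    by (simp_all add: index_mult_mat_2[of _ 2 _ 2] J_mat_1_index del: index_mult_mat(1))
  moreover have "(a + a * x) * (b - b * y) - - (b * z) * (a * w) = 1 + (x - y + z * w - x * y)" for x y z w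
  proof -
    have "(a + a * x) * (b - b * y) - - (b * z) * (a * w) = (a * b) * (1 + (x - y + z * w - x * y))"
      by (simp add: algebra_simps)
    then show ?thesis by (simp add: ab)
  qed
  moreover have "?M \<in> carrier_mat 2 2"
    using L J R by auto
  ultimately show ?thesis
    by (simp add: char_poly_mat_2)
qed

text \<open>Since \<open>S\<close> preserves the form \<open>J\<close>, its restriction \<open>L\<close> to the plane preserves \<open>K\<close>; for
  \<open>2 \<times> 2\<close> matrices \<open>L\<^sup>T K L = det L \<cdot> K\<close>. In the theorem this excludes \<open>l 1 = 0\<close>, for which
  \<open>inverse (l 1)\<close> would be the default value 0.\<close>

lemma eigenvalues_reciprocal_if_normalized:
  assumes S: "symplectic n S" and X: "X \<in> carrier_mat (2 * n) 2"
    and XJX: "transpose_mat X * J_mat n * X = J_mat 1"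
    and SX: "S * X = X * mat_diag 2 (\<lambda>i. if i = 0 then a else b)"
  shows "a * b = 1"
proof -
  define L where "L = mat_diag 2 (\<lambda>i. if i = (0::nat) then a else b)"
  have S': "S \<in> carrier_mat (2 * n) (2 * n)" and JS: "transpose_mat S * (J_mat n * S) = J_mat n"
    using S by (auto simp: symplectic_def mat_expand)
  have L: "L \<in> carrier_mat 2 2"
    by (simp add: L_def)
  have J: "J_mat 1 \<in> carrier_mat 2 2"
    using J_mat_carrier[of 1] by simp
  have "J_mat 1 = transpose_mat X * (transpose_mat S * (J_mat n * S)) * X"
    by (simp add: JS XJX)
  also have "\<dots> = transpose_mat (S * X) * J_mat n * (S * X)"
    using S' X by (simp add: mat_expand)
  also have "\<dots> = transpose_mat L * (transpose_mat X * J_mat n * X) * L"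
    using X L unfolding SX L_def[symmetric] by (simp add: mat_expand)
  finally have "J_mat 1 = transpose_mat L * J_mat 1 * L"
    unfolding XJX .
  moreover have "(transpose_mat L * J_mat 1 * L) $$ (0, 1) = a * b"
  proof -
    have "L $$ (0, 0) = a" "L $$ (0, 1) = 0" "L $$ (1, 0) = 0" "L $$ (1, 1) = b"
      by (auto simp: L_def mat_diag_def)
    then show ?thesis
      using L J by (simp add: index_mult_mat_2[of _ 2 _ 2] J_mat_1_index del: index_mult_mat(1))
  qed
  ultimately show ?thesis
    by (simp add: J_mat_1_index)
qed

section \<open>Symplectic updates in the plane of two eigenvectors\<close>

theorem theorem3:
  fixes n :: nat and S C X :: "complex mat" and l :: "nat \<Rightarrow> complex"
    and \<mu> d :: complex and x1 x2 :: "complex vec"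
  assumes "n \<ge> 1"
    and "symplectic n S"
    and "eigenvalue_mset S = inverse_pairs l {1..n}"
    and "\<mu> \<noteq> 0"
    and "eigenvector S x1 (l 1)"
    and "eigenvector S x2 (inverse (l 1))"
    and "X = mat_of_cols (2 * n) [x1, x2]"
    and "transpose_mat X * J_mat n * X = J_mat 1"
    and "d = (\<mu> + inverse \<mu>) - (l 1 + inverse (l 1))"
    and "C \<in> carrier_mat (2 * n) 2"
  shows "symplectic n (S + X * transpose_mat C) \<and>
         eigenvalue_mset (S + X * transpose_mat C)
           = {#\<mu>, inverse \<mu>#} + inverse_pairs l {2..n}
     \<longleftrightarrow>
         (\<exists>R \<in> carrier_mat 2 2.
            transpose_mat C = R * transpose_mat X * transpose_mat (J_mat n) * S \<and>
            d = l 1 * R $$ (0, 1) - inverse (l 1) * R $$ (1, 0) \<and>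
            0 = R $$ (0, 1) - R $$ (1, 0)
                + R $$ (0, 0) * R $$ (1, 1) - R $$ (0, 1) * R $$ (1, 0))"
proof -
  let ?J = "J_mat n"
  define D where "D = transpose_mat C"
  define L where "L = mat_diag 2 (\<lambda>i. if i = (0::nat) then l 1 else inverse (l 1))"
  define q where "q R = R $$ (0, 1) - R $$ (1, 0)
                + R $$ (0, 0) * R $$ (1, 1) - R $$ (0, 1) * R $$ (1, 0)" for R :: "complex mat"
  define t where "t R = l 1 * R $$ (0, 1) - inverse (l 1) * R $$ (1, 0)" for R :: "complex mat"
  note S = assms(2) and XJX = assms(8)
  have S': "S \<in> carrier_mat (2 * n) (2 * n)"
    using S by (simp add: symplectic_def)
  have D: "D \<in> carrier_mat 2 (2 * n)"
    using assms(10) by (simp add: D_def)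
  have X: "X \<in> carrier_mat (2 * n) 2" and X': "X \<in> carrier_mat (2 * n) (2 * 1)"
    using assms(7) by (auto simp: mat_of_cols_def)
  have L: "L \<in> carrier_mat 2 2"
    by (simp add: L_def)
  have SX: "S * X = X * L"
    unfolding assms(7) L_def by (rule mult_mat_of_eigenvectors[OF S' assms(5,6)])
  have ll: "l 1 * inverse (l 1) = 1"
    by (rule eigenvalues_reciprocal_if_normalized[OF S X XJX SX[unfolded L_def]])

  \<comment> \<open>Once \<open>D\<close> factors through \<open>R\<close>, each half of the claim is one scalar equation for \<open>R\<close>.\<close>
  have symp: "symplectic n (S + X * D) \<longleftrightarrow> 0 = q R"
    if R: "R \<in> carrier_mat 2 2" and DR: "D = R * transpose_mat X * transpose_mat ?J * S" for R
    using symplectic_low_rank_update_iff[OF S X' XJX, of R] quadratic_equation_2[OF R] R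
    by (simp add: DR q_def)

  have eig: "eigenvalue_mset (S + X * D) = {#\<mu>, inverse \<mu>#} + inverse_pairs l {2..n} \<longleftrightarrow> d = t R"
    if R: "R \<in> carrier_mat 2 2" and DR: "D = R * transpose_mat X * transpose_mat ?J * S"
      and qR: "0 = q R" for R
  proof -
    have "transpose_mat X * (transpose_mat ?J * X) = transpose_mat (J_mat 1)"
      using X by (simp add: XJX[symmetric] mat_expand del: One_nat_def)
    then have "R * (transpose_mat X * (transpose_mat ?J * X)) * L = R * transpose_mat (J_mat 1) * L"
      by simp
    moreover have "D * X = R * (transpose_mat X * (transpose_mat ?J * X)) * L"
      using S' X R L by (simp add: DR mat_expand SX)
    ultimately have "char_poly (L + D * X) = [:1, - (l 1 + inverse (l 1) + t R), 1:]"
      using char_poly_compression[OF ll R] qR by (simp add: L_def q_def t_def)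
    then have "proots (char_poly (L + D * X)) = {#\<mu>, inverse \<mu>#} \<longleftrightarrow>
        l 1 + inverse (l 1) + t R = \<mu> + inverse \<mu>"
      by (simp only: proots_reciprocal_quadratic[OF assms(4)])
    also have "\<dots> \<longleftrightarrow> d = t R"
      unfolding assms(9) by (auto simp: algebra_simps)
    finally have roots: "proots (char_poly (L + D * X)) = {#\<mu>, inverse \<mu>#} \<longleftrightarrow> d = t R" .

    \<comment> \<open>Passing to roots, the eigenvalues \<open>l 1\<close> and \<open>inverse (l 1)\<close> of \<open>L\<close> cancel against those of \<open>S\<close>.\<close>
    have "char_poly (S + X * D) * char_poly L = char_poly S * char_poly (L + D * X)"
      by (rule char_poly_add_low_rank_intertwined[OF S' X L D SX])
    moreover have "char_poly (S + X * D) \<noteq> 0" "char_poly L \<noteq> 0" "char_poly S \<noteq> 0"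
        "char_poly (L + D * X) \<noteq> 0"
      using S' X D L by (auto intro!: char_poly_nonzero)
    ultimately have "eigenvalue_mset (S + X * D) + proots (char_poly L)
        = eigenvalue_mset S + proots (char_poly (L + D * X))"
      unfolding eigenvalue_mset_def by (metis proots_mult)
    moreover have "proots (char_poly L) = {#l 1, inverse (l 1)#}"
    proof -
      have "upper_triangular L" "diag_mat L = [l 1, inverse (l 1)]"
        by (auto simp: L_def mat_diag_def diag_mat_def upt_rec numeral_2_eq_2)
      then have "char_poly L = [:- l 1, 1:] * [:- inverse (l 1), 1:]"
        using char_poly_upper_triangular[OF L] by simp
      then show ?thesis
        by (simp only:) (subst proots_mult; simp)
    qed
    moreover have "inverse_pairs l {1..n} = {#l 1, inverse (l 1)#} + inverse_pairs l {2..n}"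
      using assms(1) by (simp add: inverse_pairs_def sum.atLeast_Suc_atMost numeral_2_eq_2)
    ultimately have "eigenvalue_mset (S + X * D)
        = proots (char_poly (L + D * X)) + inverse_pairs l {2..n}"
      using assms(3) by simp
    then show ?thesis
      by (simp only: add_right_cancel roots)
  qed

  have factor: "\<exists>R \<in> carrier_mat 2 2. D = R * transpose_mat X * transpose_mat ?J * S"
    if T: "symplectic n (S + X * D)"
  proof -
    have "D \<in> carrier_mat (2 * 1) (2 * n)"
      using D by simp
    from symplectic_add_factors[OF S T X' this XJX] show ?thesis
      by (metis mult.right_neutral)
  qed
  show ?thesis
    unfolding D_def[symmetric] q_def[symmetric] t_def[symmetric]
  proof (intro iffI; elim conjE bexE)
    assume T: "symplectic n (S + X * D)"
      and ev: "eigenvalue_mset (S + X * D) = {#\<mu>, inverse \<mu>#} + inverse_pairs l {2..n}"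
    from factor[OF T] obtain R
      where R: "R \<in> carrier_mat 2 2" "D = R * transpose_mat X * transpose_mat ?J * S" ..
    have "0 = q R"
      using symp[OF R] T by (rule iffD1)
    moreover have "d = t R"
      using eig[OF R \<open>0 = q R\<close>] ev by (rule iffD1)
    ultimately show "\<exists>R \<in> carrier_mat 2 2.
        D = R * transpose_mat X * transpose_mat ?J * S \<and> d = t R \<and> 0 = q R"
      using R by (intro bexI[of _ R] conjI)
  next
    fix R
    assume R: "R \<in> carrier_mat 2 2" "D = R * transpose_mat X * transpose_mat ?J * S"
      and "d = t R" "0 = q R"
    show "symplectic n (S + X * D) \<and>
        eigenvalue_mset (S + X * D) = {#\<mu>, inverse \<mu>#} + inverse_pairs l {2..n}"
      using iffD2[OF symp[OF R] \<open>0 = q R\<close>] iffD2[OF eig[OF R \<open>0 = q R\<close>] \<open>d = t R\<close>] by (rule conjI)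
  qed
qed

end
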